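(* Let $n\ge 3$ and let $\lambda:L_n\longrightarrow\mathrm{GL}_n(\mathbb{C})$ be a complex $2$-local representation of the triplet group $L_n$. Define two maps $\hat\lambda_1,\hat\lambda_2:VL_n\longrightarrow\mathrm{GL}_n(\mathbb{C})$ on generators by \[ \hat\lambda_1(\ell_i)=\lambda(\ell_i),\quad \hat\lambda_1(\rho_i)=\lambda(\ell_i),\qquad 1\le i\le n-1, \] \[ \hat\lambda_2(\ell_i)=\lambda(\ell_i),\quad \hat\lambda_2(\rho_i)=-\lambda(\ell_i),\qquad 1\le i\le n-1. \] Then both $\hat\lambda_1$ and $\hat\lambda_2$ are well-defined representations of the virtual triplet group $VL_n$. Moreover, each of them induces a representation of the welded triplet group $WL_n$.
   Context: The triplet group $L_n$ is the group generated by $\ell_1,\ldots,\ell_{n-1}$ subject to $\ell_i^2=1$ for $1\le i\le n-1$ and $\ell_i\ell_{i+1}\ell_i=\ell_{i+1}\ell_i\ell_{i+1}$ for $1\le i\le n-2$ (no commutation relations among the $\ell_i$ are imposed). The virtual triplet group $VL_n$ is generated by $\ell_1,\ldots,\ell_{n-1},\rho_1,\ldots,\rho_{n-1}$ subject to the relations $\ell_i^2=1$ ($1\le i\le n-1$) and $\ell_i\ell_{i+1}\ell_i=\ell_{i+1}\ell_i\ell_{i+1}$ ($1\le i\le n-2$) of $L_n$ together with: $\rho_i^2=1$ ($1\le i\le n-1$); $\rho_i\rho_j=\rho_j\rho_i$ ($|i-j|\ge2$); $\rho_i\rho_{i+1}\rho_i=\rho_{i+1}\rho_i\rho_{i+1}$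 ($1\le i\le n-2$); $\ell_i\rho_j=\rho_j\ell_i$ ($|i-j|\ge2$); $\rho_i\rho_{i+1}\ell_i=\ell_{i+1}\rho_i\rho_{i+1}$ ($1\le i\le n-2$). The welded triplet group $WL_n$ is the quotient of $VL_n$ by the additional relations $\rho_i\ell_{i+1}\ell_i=\ell_{i+1}\ell_i\rho_{i+1}$ ($1\le i\le n-2$). A representation $\lambda:L_n\to\mathrm{GL}_n(\mathbb{C})$ is $2$-local if for each $1\le i\le n-1$ the matrix $\lambda(\ell_i)$ is block diagonal with diagonal blocks $I_{i-1},M_i,I_{n-i-1}$ for some $M_i\in\mathrm{GL}_2(\mathbb{C})$ (the $M_i$ may differ), where $I_r$ is the $r\times r$ identity matrix. *)

theory Defs
  imports "HOL-Algebra.Coset" "Jordan_Normal_Form.Matrix"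
begin

section \<open>Groups given by generators and relations\<close>

text \<open>A word is a list of letters \<open>(a, b)\<close>: the generator \<open>a\<close> if \<open>b\<close> is false, its formal inverse
  if \<open>b\<close> is true. A relation \<open>u = v\<close> is the pair \<open>(u, v)\<close>.\<close>

type_synonym 'a word = "('a \<times> bool) list"

definition words :: "'a set \<Rightarrow> 'a word set" where
  "words S = lists (S \<times> UNIV)"

definition pos :: "'a list \<Rightarrow> 'a word" where
  "pos as = map (\<lambda>a. (a, False)) as"

inductive word_eq :: "'a set \<Rightarrow> ('a word \<times> 'a word) set \<Rightarrow> 'a word \<Rightarrow> 'a word \<Rightarrow> bool"
  for S R where
  refl: "u \<in> words S \<Longrightarrow> word_eq S R u u"
| sym: "word_eq S R u v \<Longrightarrow> word_eq S R v u"
| trans: "word_eq S R u v \<Longrightarrow> word_eq S R v w \<Longrightarrow> word_eq S R u w"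
| append: "word_eq S R u v \<Longrightarrow> word_eq S R u' v' \<Longrightarrow> word_eq S R (u @ u') (v @ v')"
| cancel: "a \<in> S \<Longrightarrow> word_eq S R [(a, b), (a, \<not> b)] []"
| relation: "(u, v) \<in> R \<Longrightarrow> u \<in> words S \<Longrightarrow> v \<in> words S \<Longrightarrow> word_eq S R u v"

definition word_class :: "'a set \<Rightarrow> ('a word \<times> 'a word) set \<Rightarrow> 'a word \<Rightarrow> 'a word set" where
  "word_class S R u = {v. word_eq S R u v}"

definition presented_group :: "'a set \<Rightarrow> ('a word \<times> 'a word) set \<Rightarrow> 'a word set monoid" where
  "presented_group S R =
    \<lparr>carrier = word_class S R ` words S,
     monoid.mult = (\<lambda>X Y. \<Union>u\<in>X. \<Union>v\<in>Y. word_class S R (u @ v)),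
     one = word_class S R []\<rparr>"

definition presented_gen :: "'a set \<Rightarrow> ('a word \<times> 'a word) set \<Rightarrow> 'a \<Rightarrow> 'a word set" where
  "presented_gen S R a = word_class S R [(a, False)]"

definition normal_closure :: "('a, 'b) monoid_scheme \<Rightarrow> 'a set \<Rightarrow> 'a set" where
  "normal_closure G A = \<Inter>{N. N \<lhd> G \<and> A \<subseteq> N}"

text \<open>Sanity check: \<^const>\<open>presented_group\<close> is a group generated subject to its relations.\<close>

lemma words_simps [simp]:
  "[] \<in> words S" "(x # u) \<in> words S \<longleftrightarrow> fst x \<in> S \<and> u \<in> words S"
  "u @ v \<in> words S \<longleftrightarrow> u \<in> words S \<and> v \<in> words S"
  by (auto simp: words_def mem_Times_iff)

lemma word_eq_words: "word_eq S R u v \<Longrightarrow> u \<in> words S \<and> v \<in> words S"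
  by (induction rule: word_eq.induct) auto

lemma word_class_eq_iff:
  "u \<in> words S \<Longrightarrow> word_class S R u = word_class S R v \<longleftrightarrow> word_eq S R u v"
  unfolding word_class_def set_eq_iff mem_Collect_eq
  by (meson word_eq.refl word_eq.sym word_eq.trans)

lemma presented_mult:
  assumes "u \<in> words S" "v \<in> words S"
  shows "word_class S R u \<otimes>\<^bsub>presented_group S R\<^esub> word_class S R v = word_class S R (u @ v)"
proof -
  have eq: "word_class S R (u' @ v') = word_class S R (u @ v)"
    if "u' \<in> word_class S R u" "v' \<in> word_class S R v" for u' v'
  proof -
    have "word_eq S R (u @ v) (u' @ v')"
      using that by (intro word_eq.append) (auto simp: word_class_def)
    then show ?thesis using assms by (simp add: word_class_eq_iff[symmetric])
  qed
  have "u \<in> word_class S R u" "v \<in> word_class S R v"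
    using assms by (simp_all add: word_class_def word_eq.refl)
  then have "(\<Union>u'\<in>word_class S R u. \<Union>v'\<in>word_class S R v. word_class S R (u' @ v'))
    = word_class S R (u @ v)"
    using eq by blast
  then show ?thesis by (simp add: presented_group_def)
qed

lemma word_left_inverse:
  assumes "u \<in> words S"
  shows "\<exists>v\<in>words S. word_eq S R (v @ u) []"
  using assms
proof (induction u)
  case Nil
  then show ?case by (intro bexI[of _ "[]"]) (auto intro: word_eq.refl)
next
  case (Cons x u)
  obtain a b where x: "x = (a, b)" by (cases x)
  obtain v where v: "v \<in> words S" "word_eq S R (v @ u) []" using Cons by auto
  have "word_eq S R [(a, \<not> b), (a, b)] []"
    using word_eq.cancel[of a S R "\<not> b"] Cons.prems x by simp
  then have "word_eq S R (v @ ([(a, \<not> b), (a, b)] @ u)) (v @ ([] @ u))"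
    using v Cons.prems by (intro word_eq.append word_eq.refl) auto
  then have "word_eq S R ((v @ [(a, \<not> b)]) @ x # u) []"
    using v(2) x by (auto intro: word_eq.trans)
  then show ?case using v(1) Cons.prems x by (intro bexI[of _ "v @ [(a, \<not> b)]"]) auto
qed

lemma presented_group_is_group: "group (presented_group S R)" (is "group ?G")
proof (rule groupI)
  have car: "carrier ?G = word_class S R ` words S" and one: "\<one>\<^bsub>?G\<^esub> = word_class S R []"
    by (auto simp: presented_group_def)
  show "\<one>\<^bsub>?G\<^esub> \<in> carrier ?G" by (simp add: car one)
  show "x \<otimes>\<^bsub>?G\<^esub> y \<in> carrier ?G" if "x \<in> carrier ?G" "y \<in> carrier ?G" for x y
    using that by (auto simp: car presented_mult)
  show "x \<otimes>\<^bsub>?G\<^esub> y \<otimes>\<^bsub>?G\<^esub> z = x \<otimes>\<^bsub>?G\<^esub> (y \<otimes>\<^bsub>?G\<^esub> z)"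
    if "x \<in> carrier ?G" "y \<in> carrier ?G" "z \<in> carrier ?G" for x y z
    using that by (auto simp: car presented_mult)
  show "\<one>\<^bsub>?G\<^esub> \<otimes>\<^bsub>?G\<^esub> x = x" if "x \<in> carrier ?G" for x
    using that by (auto simp: car one presented_mult)
  show "\<exists>y\<in>carrier ?G. y \<otimes>\<^bsub>?G\<^esub> x = \<one>\<^bsub>?G\<^esub>" if x: "x \<in> carrier ?G" for x
  proof -
    obtain u where u: "u \<in> words S" "x = word_class S R u" using x by (auto simp: car)
    obtain v where v: "v \<in> words S" "word_eq S R (v @ u) []"
      using word_left_inverse[OF u(1)] by blast
    have "word_class S R v \<otimes>\<^bsub>?G\<^esub> x = \<one>\<^bsub>?G\<^esub>"
      using u v by (simp add: presented_mult one word_class_eq_iff)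
    then show ?thesis using v(1) by (auto simp: car)
  qed
qed

lemma presented_relation:
  assumes "(u, v) \<in> R" "u \<in> words S" "v \<in> words S"
  shows "word_class S R u = word_class S R v"
  using assms by (simp add: word_class_eq_iff word_eq.relation)


section \<open>Triplet groups, virtual triplet groups and welded triplet groups\<close>

datatype gen = Ell nat | Rho nat

text \<open>The index ranges \<open>{1..n-1}\<close> and \<open>{1..n-2}\<close> use truncated subtraction; they are empty
  whenever the upper bound is not positive, as they should be.\<close>

definition triplet_rels :: "nat \<Rightarrow> (gen word \<times> gen word) set" where
  "triplet_rels n =
     {(pos [Ell i, Ell i], []) | i. i \<in> {1..n-1}} \<union>
     {(pos [Ell i, Ell (i+1), Ell i], pos [Ell (i+1), Ell i, Ell (i+1)]) | i. i \<in> {1..n-2}}"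

definition triplet_group :: "nat \<Rightarrow> gen word set monoid" where
  "triplet_group n = presented_group (Ell ` {1..n-1}) (triplet_rels n)"

definition triplet_gen :: "nat \<Rightarrow> nat \<Rightarrow> gen word set" where
  "triplet_gen n i = presented_gen (Ell ` {1..n-1}) (triplet_rels n) (Ell i)"

definition virtual_gens :: "nat \<Rightarrow> gen set" where
  "virtual_gens n = Ell ` {1..n-1} \<union> Rho ` {1..n-1}"

definition virtual_rels :: "nat \<Rightarrow> (gen word \<times> gen word) set" where
  "virtual_rels n = triplet_rels n \<union>
     {(pos [Rho i, Rho i], []) | i. i \<in> {1..n-1}} \<union>
     {(pos [Rho i, Rho j], pos [Rho j, Rho i]) | i j.
        i \<in> {1..n-1} \<and> j \<in> {1..n-1} \<and> \<bar>int i - int j\<bar> \<ge> 2} \<union>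
     {(pos [Rho i, Rho (i+1), Rho i], pos [Rho (i+1), Rho i, Rho (i+1)]) | i. i \<in> {1..n-2}} \<union>
     {(pos [Ell i, Rho j], pos [Rho j, Ell i]) | i j.
        i \<in> {1..n-1} \<and> j \<in> {1..n-1} \<and> \<bar>int i - int j\<bar> \<ge> 2} \<union>
     {(pos [Rho i, Rho (i+1), Ell i], pos [Ell (i+1), Rho i, Rho (i+1)]) | i. i \<in> {1..n-2}}"

definition virtual_triplet_group :: "nat \<Rightarrow> gen word set monoid" where
  "virtual_triplet_group n = presented_group (virtual_gens n) (virtual_rels n)"

definition virtual_gen :: "nat \<Rightarrow> gen \<Rightarrow> gen word set" where
  "virtual_gen n g = presented_gen (virtual_gens n) (virtual_rels n) g"

text \<open>A relation \<open>x = y\<close> is imposed on a group by factoring out \<open>x y\<^sup>-\<^sup>1\<close>.\<close>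

definition welded_relators :: "nat \<Rightarrow> gen word set set" where
  "welded_relators n =
     (let G = virtual_triplet_group n; l = (\<lambda>i. virtual_gen n (Ell i));
          r = (\<lambda>i. virtual_gen n (Rho i))
      in {(r i \<otimes>\<^bsub>G\<^esub> l (i+1) \<otimes>\<^bsub>G\<^esub> l i) \<otimes>\<^bsub>G\<^esub> inv\<^bsub>G\<^esub> (l (i+1) \<otimes>\<^bsub>G\<^esub> l i \<otimes>\<^bsub>G\<^esub> r (i+1)) | i.
            i \<in> {1..n-2}})"

definition welded_kernel :: "nat \<Rightarrow> gen word set set" where
  "welded_kernel n = normal_closure (virtual_triplet_group n) (welded_relators n)"

definition welded_triplet_group :: "nat \<Rightarrow> gen word set set monoid" where
  "welded_triplet_group n = virtual_triplet_group n Mod welded_kernel n"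

definition welded_proj :: "nat \<Rightarrow> gen word set \<Rightarrow> gen word set set" where
  "welded_proj n x = welded_kernel n #>\<^bsub>virtual_triplet_group n\<^esub> x"


section \<open>Representations\<close>

definition GL :: "nat \<Rightarrow> complex mat monoid" where
  "GL n = units_of (ring_mat TYPE(complex) n ())"

definition two_local :: "nat \<Rightarrow> (gen word set \<Rightarrow> complex mat) \<Rightarrow> bool" where
  "two_local n lam \<longleftrightarrow>
     (\<forall>i\<in>{1..n-1}. \<exists>M\<in>carrier (GL 2).
        lam (triplet_gen n i) = diag_block_mat [1\<^sub>m (i - 1), M, 1\<^sub>m (n - i - 1)])"

definition lam_hat1 :: "nat \<Rightarrow> (gen word set \<Rightarrow> complex mat) \<Rightarrow> gen \<Rightarrow> complex mat" where
  "lam_hat1 n lam g =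
     (case g of Ell i \<Rightarrow> lam (triplet_gen n i) | Rho i \<Rightarrow> lam (triplet_gen n i))"

definition lam_hat2 :: "nat \<Rightarrow> (gen word set \<Rightarrow> complex mat) \<Rightarrow> gen \<Rightarrow> complex mat" where
  "lam_hat2 n lam g =
     (case g of Ell i \<Rightarrow> lam (triplet_gen n i) | Rho i \<Rightarrow> - lam (triplet_gen n i))"

text \<open>\<open>f\<close>, given on the generators of the virtual triplet group, is well defined as the
  representation \<open>\<phi>\<close>: \<open>\<phi>\<close> is the one and only homomorphism with these values (functions being
  compared on the carrier only).\<close>

definition defines_virtual_rep ::
    "nat \<Rightarrow> (gen \<Rightarrow> complex mat) \<Rightarrow> (gen word set \<Rightarrow> complex mat) \<Rightarrow> bool" where
  "defines_virtual_rep n f \<phi> \<longleftrightarrow>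
     \<phi> \<in> hom (virtual_triplet_group n) (GL n) \<and>
     (\<forall>g\<in>virtual_gens n. \<phi> (virtual_gen n g) = f g) \<and>
     (\<forall>\<psi>\<in>hom (virtual_triplet_group n) (GL n).
        (\<forall>g\<in>virtual_gens n. \<psi> (virtual_gen n g) = f g) \<longrightarrow>
        (\<forall>x\<in>carrier (virtual_triplet_group n). \<psi> x = \<phi> x))"

definition induces_welded_rep :: "nat \<Rightarrow> (gen word set \<Rightarrow> complex mat) \<Rightarrow> bool" where
  "induces_welded_rep n \<phi> \<longleftrightarrow>
     (\<exists>\<mu>\<in>hom (welded_triplet_group n) (GL n).
        \<forall>x\<in>carrier (virtual_triplet_group n). \<mu> (welded_proj n x) = \<phi> x)"

end

theory Submission
  imports Defs
begin

text \<open>Every defining relation of \<open>VL\<^sub>n\<close>, and every welded relation, has the same parity of letters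
  \<open>\<rho>\<close> on its two sides, and becomes one of three relations when each \<open>\<rho>\<^sub>i\<close> is replaced by \<open>\<ell>\<^sub>i\<close>:
  \<open>\<ell>\<^sub>i\<^sup>2 = 1\<close>, the braid relation of \<open>\<ell>\<^sub>i\<close> and \<open>\<ell>\<^sub>i\<^sub>+\<^sub>1\<close>, or the far commutation
  \<open>\<ell>\<^sub>i \<ell>\<^sub>j = \<ell>\<^sub>j \<ell>\<^sub>i\<close> for \<open>\<bar>i - j\<bar> \<ge> 2\<close>. The first two hold in \<open>L\<^sub>n\<close>. The third does not, but it
  holds for the matrices \<open>\<lambda>(\<ell>\<^sub>i)\<close> because 2-locality makes the blocks of \<open>\<lambda>(\<ell>\<^sub>i)\<close> and \<open>\<lambda>(\<ell>\<^sub>j)\<close>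
  act on disjoint pairs of coordinates (\<open>commute_disjoint_supports\<close>,
  \<open>two_local_block_support\<close>). Hence \<open>\<ell>\<^sub>i \<mapsto> \<lambda>(\<ell>\<^sub>i)\<close>, \<open>\<rho>\<^sub>i \<mapsto> \<lambda>(\<ell>\<^sub>i)\<close> satisfies all relations, and
  equality of parities lets each \<open>\<rho>\<^sub>i\<close> acquire a sign.

  Both maps are instances of one statement about an arbitrary group, \<open>twisted_virtual_hom\<close>, in
  which the sign is a central element \<open>z\<close> with \<open>z\<^sup>2 = 1\<close>. The passage from values on generators to
  a homomorphism is von Dyck's theorem (\<open>von_dyck\<close>), its uniqueness is
  \<open>hom_presented_unique\<close>, and the passage to \<open>WL\<^sub>n\<close> is the universal property of a quotient group:
  the kernel is normal and contains the welded relators, so it contains their normal closure.\<close>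

section \<open>The universal property of a presented group\<close>

definition word_val :: "('b, 'm) monoid_scheme \<Rightarrow> ('a \<Rightarrow> 'b) \<Rightarrow> 'a word \<Rightarrow> 'b" where
  "word_val H f u =
     foldr (\<lambda>(a, b) x. (if b then inv\<^bsub>H\<^esub> f a else f a) \<otimes>\<^bsub>H\<^esub> x) u \<one>\<^bsub>H\<^esub>"

lemma word_val_simps [simp]:
  "word_val H f [] = \<one>\<^bsub>H\<^esub>"
  "word_val H f ((a, b) # u) = (if b then inv\<^bsub>H\<^esub> f a else f a) \<otimes>\<^bsub>H\<^esub> word_val H f u"
  by (simp_all add: word_val_def)

context group
begin

lemma word_val_closed:
  assumes "\<And>a. a \<in> S \<Longrightarrow> f a \<in> carrier G" "u \<in> words S"
  shows "word_val G f u \<in> carrier G"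
  using assms(2) by (induction u) (auto simp: assms(1))

lemma word_val_append:
  assumes "\<And>a. a \<in> S \<Longrightarrow> f a \<in> carrier G" "u \<in> words S" "v \<in> words S"
  shows "word_val G f (u @ v) = word_val G f u \<otimes> word_val G f v"
  using assms(2)
proof (induction u)
  case Nil
  then show ?case using assms by (simp add: word_val_closed[of S])
next
  case (Cons x u)
  then show ?case
    using assms by (cases x) (auto simp: word_val_closed[of S] m_assoc)
qed

lemma word_val_respects_word_eq:
  assumes f: "\<And>a. a \<in> S \<Longrightarrow> f a \<in> carrier G"
    and rels: "\<And>u v. (u, v) \<in> R \<Longrightarrow> u \<in> words S \<Longrightarrow> v \<in> words S \<Longrightarrow>
      word_val G f u = word_val G f v"
    and "word_eq S R u v"
  shows "word_val G f u = word_val G f v"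
  using assms(3)
proof (induction rule: word_eq.induct)
  case (append u v u' v')
  then show ?case by (metis f word_eq_words word_val_append)
next
  case (cancel a b)
  then show ?case by (simp add: f)
qed (simp_all add: rels)

text \<open>Von Dyck's theorem: a word and its value depend only on the class of the word once the
  relations hold in the target, so evaluation descends to classes.\<close>

lemma von_dyck:
  assumes f: "\<And>a. a \<in> S \<Longrightarrow> f a \<in> carrier G"
    and rels: "\<And>u v. (u, v) \<in> R \<Longrightarrow> u \<in> words S \<Longrightarrow> v \<in> words S \<Longrightarrow>
      word_val G f u = word_val G f v"
  obtains \<phi> where "\<phi> \<in> hom (presented_group S R) G"
    and "\<And>a. a \<in> S \<Longrightarrow> \<phi> (presented_gen S R a) = f a"
proof
  define \<phi> where "\<phi> X = word_val G f (SOME u. u \<in> X)" for X :: "'c word set"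
  have \<phi>: "\<phi> (word_class S R u) = word_val G f u" if "u \<in> words S" for u
  proof -
    have "u \<in> word_class S R u"
      using that by (simp add: word_class_def word_eq.refl)
    then have "(SOME v. v \<in> word_class S R u) \<in> word_class S R u"
      by (rule someI)
    then show ?thesis
      using word_val_respects_word_eq[OF f rels]
      by (simp add: \<phi>_def word_class_def)
  qed
  have car: "carrier (presented_group S R) = word_class S R ` words S"
    by (simp add: presented_group_def)
  show "\<phi> \<in> hom (presented_group S R) G"
    by (rule homI)
      (auto simp: car \<phi> presented_mult word_val_append[of S] word_val_closed[of S] f)
  show "\<phi> (presented_gen S R a) = f a" if "a \<in> S" for a
    using that by (simp add: presented_gen_def \<phi> f)
qed

text \<open>The letter \<open>(a, True)\<close> is only a formal inverse, so the point is that its class is the inverse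
  of the class of \<open>a\<close>. It follows that a homomorphism is determined by its values on generators.\<close>

lemma hom_presented_word_class:
  assumes \<phi>: "\<phi> \<in> hom (presented_group S R) G" and "u \<in> words S"
  shows "\<phi> (word_class S R u) = word_val G (\<lambda>a. \<phi> (presented_gen S R a)) u"
proof -
  let ?P = "presented_group S R"
  interpret P: group ?P by (rule presented_group_is_group)
  interpret \<phi>: group_hom ?P G \<phi>
    using \<phi> by unfold_locales
  have car: "word_class S R u \<in> carrier ?P" if "u \<in> words S" for u
    using that by (simp add: presented_group_def)
  have gen_car: "presented_gen S R a \<in> carrier ?P" if "a \<in> S" for a
    using that by (simp add: presented_gen_def car)
  have one: "word_class S R [] = \<one>\<^bsub>?P\<^esub>"
    by (simp add: presented_group_def)
  have letter: "word_class S R [(a, b)] =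
      (if b then inv\<^bsub>?P\<^esub> presented_gen S R a else presented_gen S R a)" if "a \<in> S" for a b
  proof (cases b)
    case True
    have "word_class S R [(a, True)] \<otimes>\<^bsub>?P\<^esub> presented_gen S R a = \<one>\<^bsub>?P\<^esub>"
      using that word_eq.cancel[of a S R True]
      by (simp add: presented_gen_def presented_mult word_class_eq_iff flip: one)
    then show ?thesis
      using True that P.inv_equality car by (simp add: presented_gen_def)
  qed (simp add: presented_gen_def)
  show ?thesis using assms(2)
  proof (induction u)
    case Nil
    then show ?case by (simp add: one)
  next
    case (Cons x u)
    obtain a b where x: "x = (a, b)" by (cases x)
    with Cons.prems have a: "a \<in> S" and u: "u \<in> words S" by auto
    have "\<phi> (word_class S R (x # u)) = \<phi> (word_class S R [(a, b)]) \<otimes> \<phi> (word_class S R u)"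
      using a u presented_mult[of "[(a, b)]" S u R] car by (simp add: x flip: \<phi>.hom_mult)
    also have "\<phi> (word_class S R [(a, b)]) =
        (if b then inv \<phi> (presented_gen S R a) else \<phi> (presented_gen S R a))"
      using a gen_car[OF a] by (simp add: letter)
    finally show ?case using Cons.IH u by (simp add: x)
  qed
qed

lemma hom_presented_unique:
  assumes "\<phi> \<in> hom (presented_group S R) G" "\<psi> \<in> hom (presented_group S R) G"
    and agree: "\<And>a. a \<in> S \<Longrightarrow> \<phi> (presented_gen S R a) = \<psi> (presented_gen S R a)"
    and "x \<in> carrier (presented_group S R)"
  shows "\<phi> x = \<psi> x"
proof -
  have "word_val G (\<lambda>a. \<phi> (presented_gen S R a)) u = word_val G (\<lambda>a. \<psi> (presented_gen S R a)) u"
    if "u \<in> words S" for u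
    using that by (induction u) (auto simp: agree)
  with assms show ?thesis
    by (auto simp: presented_group_def hom_presented_word_class)
qed

end

text \<open>The hypothesis \<open>A \<subseteq> carrier G\<close> keeps the intersected family nonempty: otherwise
  \<open>normal_closure G A\<close> would be \<open>UNIV\<close>.\<close>

lemma normal_closure_normal:
  assumes "group G" and "A \<subseteq> carrier G"
  shows "normal_closure G A \<lhd> G"
proof -
  interpret group G by fact
  let ?F = "{N. N \<lhd> G \<and> A \<subseteq> N}"
  have "carrier G \<in> ?F"
    using assms(2) by (auto intro!: normal_invI subgroup_self)
  then have "subgroup (\<Inter>?F) G"
    by (intro subgroups_Inter) (auto simp: normal_inv_iff)
  then show ?thesis
    unfolding normal_closure_def by (rule normal_invI) (auto simp: normal_inv_iff)
qed

section \<open>Sign twists of a representation in an arbitrary group\<close>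

definition twisted_assignment ::
    "('b, 'm) monoid_scheme \<Rightarrow> (nat \<Rightarrow> 'b) \<Rightarrow> 'b \<Rightarrow> gen \<Rightarrow> 'b" where
  "twisted_assignment H a z g = (case g of Ell i \<Rightarrow> a i | Rho i \<Rightarrow> z \<otimes>\<^bsub>H\<^esub> a i)"

text \<open>Each relation is checked by moving the letters \<open>z\<close> to the front: what is left is a relation
  between the \<open>a i\<close>, and the powers of \<open>z\<close> on the two sides have exponents of the same parity, hence
  are equal since \<open>z \<otimes> z = \<one>\<close>. The welded relation contains one \<open>\<rho>\<close> on either side and
  reduces to the braid relation.\<close>

lemma (in group) twisted_virtual_hom:
  assumes a: "\<And>i. i \<in> {1..n-1} \<Longrightarrow> a i \<in> carrier G"
    and square: "\<And>i. i \<in> {1..n-1} \<Longrightarrow> a i \<otimes> a i = \<one>"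
    and braid: "\<And>i. i \<in> {1..n-2} \<Longrightarrow> a i \<otimes> (a (i+1) \<otimes> a i) = a (i+1) \<otimes> (a i \<otimes> a (i+1))"
    and far: "\<And>i j. i \<in> {1..n-1} \<Longrightarrow> j \<in> {1..n-1} \<Longrightarrow> i + 2 \<le> j \<Longrightarrow> a i \<otimes> a j = a j \<otimes> a i"
    and z: "z \<in> carrier G" "z \<otimes> z = \<one>"
    and central: "\<And>i. i \<in> {1..n-1} \<Longrightarrow> a i \<otimes> z = z \<otimes> a i"
  obtains \<phi> where "\<phi> \<in> hom (virtual_triplet_group n) G"
    and "\<And>g. g \<in> virtual_gens n \<Longrightarrow> \<phi> (virtual_gen n g) = twisted_assignment G a z g"
    and "welded_relators n \<subseteq> kernel (virtual_triplet_group n) G \<phi>"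
proof -
  let ?f = "twisted_assignment G a z" and ?V = "virtual_triplet_group n"
  have zz: "z \<otimes> (z \<otimes> x) = x" if "x \<in> carrier G" for x
    using that z by (simp flip: m_assoc)
  \<comment> \<open>Rewriting with \<open>pull\<close> and \<open>zz\<close> brings every product to the form \<open>a\<^sub>i a\<^sub>j \<dots>\<close> or \<open>z a\<^sub>i a\<^sub>j \<dots>\<close>.\<close>
  have pull: "a i \<otimes> (z \<otimes> x) = z \<otimes> (a i \<otimes> x)" if "i \<in> {1..n-1}" "x \<in> carrier G" for i x
    using that z a central by (simp flip: m_assoc)
  have far': "a i \<otimes> a j = a j \<otimes> a i"
    if "i \<in> {1..n-1}" "j \<in> {1..n-1}" "\<bar>int i - int j\<bar> \<ge> 2" for i j
    using that far[of i j] far[of j i] by (cases "i < j") auto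
  have f: "?f g \<in> carrier G" if "g \<in> virtual_gens n" for g
    using that a z by (auto simp: virtual_gens_def twisted_assignment_def)
  have next_idx: "i \<in> {1..n-1}" "i + 1 \<in> {1..n-1}" "Suc i \<in> {1..n-1}" if "i \<in> {1..n-2}" for i
    using that by auto
  have rels: "word_val G ?f u = word_val G ?f v" if uv: "(u, v) \<in> virtual_rels n" for u v
  proof -
    note [simp] = pos_def twisted_assignment_def m_assoc a z zz pull square central
    consider (involution) i where "i \<in> {1..n-1}"
          "(u, v) \<in> {(pos [Ell i, Ell i], []), (pos [Rho i, Rho i], [])}"
      | (triple) i where "i \<in> {1..n-2}"
          "(u, v) \<in> {(pos [Ell i, Ell (i+1), Ell i], pos [Ell (i+1), Ell i, Ell (i+1)]),
             (pos [Rho i, Rho (i+1), Rho i], pos [Rho (i+1), Rho i, Rho (i+1)]),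
             (pos [Rho i, Rho (i+1), Ell i], pos [Ell (i+1), Rho i, Rho (i+1)])}"
      | (distant) i j where "i \<in> {1..n-1}" "j \<in> {1..n-1}" "\<bar>int i - int j\<bar> \<ge> 2"
          "(u, v) \<in> {(pos [Rho i, Rho j], pos [Rho j, Rho i]), (pos [Ell i, Rho j], pos [Rho j, Ell i])}"
      using uv unfolding virtual_rels_def triplet_rels_def by blast
    then show ?thesis
    proof cases
      case (involution i)
      then show ?thesis by auto
    next
      case (triple i)
      then show ?thesis
        using next_idx[OF triple(1)] braid[OF triple(1)]
        by (auto simp del: atLeastAtMost_iff)
    next
      case (distant i j)
      then show ?thesis
        using far'[OF distant(1-3)] by (auto simp del: atLeastAtMost_iff)
    qed
  qed
  obtain \<phi> where \<phi>: "\<phi> \<in> hom ?V G"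
    and gens: "\<And>g. g \<in> virtual_gens n \<Longrightarrow> \<phi> (virtual_gen n g) = ?f g"
    using von_dyck[of "virtual_gens n" ?f "virtual_rels n"] f rels
    unfolding virtual_triplet_group_def virtual_gen_def by metis
  show thesis
  proof
    interpret V: group ?V
      by (simp add: virtual_triplet_group_def presented_group_is_group)
    interpret \<phi>: group_hom ?V G \<phi>
      using \<phi> by unfold_locales
    show "welded_relators n \<subseteq> kernel ?V G \<phi>"
    proof
      fix x assume "x \<in> welded_relators n"
      then obtain i where i: "i \<in> {1..n-2}"
        and x: "x = (virtual_gen n (Rho i) \<otimes>\<^bsub>?V\<^esub> virtual_gen n (Ell (i+1)) \<otimes>\<^bsub>?V\<^esub> virtual_gen n (Ell i))
          \<otimes>\<^bsub>?V\<^esub> inv\<^bsub>?V\<^esub> (virtual_gen n (Ell (i+1)) \<otimes>\<^bsub>?V\<^esub> virtual_gen n (Ell i) \<otimes>\<^bsub>?V\<^esub> virtual_gen n (Rho (i+1)))"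
        by (auto simp: welded_relators_def Let_def)
      note idx = next_idx[OF i]
      have mem: "Ell i \<in> virtual_gens n" "Ell (i+1) \<in> virtual_gens n" "Rho i \<in> virtual_gens n"
        "Rho (i+1) \<in> virtual_gens n"
        using idx by (auto simp: virtual_gens_def)
      have car: "virtual_gen n g \<in> carrier ?V" if "g \<in> virtual_gens n" for g
        using that by (simp add: virtual_gen_def virtual_triplet_group_def presented_gen_def
            presented_group_def)
      have "z \<otimes> a i \<otimes> a (i+1) \<otimes> a i = a (i+1) \<otimes> a i \<otimes> (z \<otimes> a (i+1))"
        using braid[OF i] idx a z pull by (simp add: m_assoc)
      then show "x \<in> kernel ?V G \<phi>"
        using mem car idx a z unfolding x
        by (simp add: kernel_def gens twisted_assignment_def)
    qed
  qed (use \<phi> gens in auto)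
qed

section \<open>Block-diagonal matrices with disjoint blocks commute\<close>

definition supported_on :: "nat set \<Rightarrow> 'a::zero mat \<Rightarrow> bool" where
  "supported_on S D \<longleftrightarrow>
     (\<forall>r < dim_row D. \<forall>c < dim_col D. r \<notin> S \<or> c \<notin> S \<longrightarrow> D $$ (r, c) = 0)"

text \<open>In the sum for an entry of \<open>D * E\<close>, a nonzero term would need its middle index both in the
  columns of \<open>D\<close>, i.e. in \<open>S\<close>, and in the rows of \<open>E\<close>, i.e. in \<open>T\<close>.\<close>

lemma mult_disjoint_supports:
  fixes D E :: "'a::semiring_0 mat"
  assumes "D \<in> carrier_mat n n" "E \<in> carrier_mat n n"
    and "supported_on S D" "supported_on T E" "S \<inter> T = {}"
  shows "D * E = 0\<^sub>m n n"
proof (rule eq_matI)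
  fix r c assume "r < dim_row (0\<^sub>m n n :: 'a mat)" "c < dim_col (0\<^sub>m n n :: 'a mat)"
  then have rc: "r < n" "c < n" by auto
  have "D $$ (r, k) * E $$ (k, c) = 0" if "k < n" for k
  proof (cases "k \<in> S")
    case True
    then have "k \<notin> T" using \<open>S \<inter> T = {}\<close> by blast
    then have "E $$ (k, c) = 0" using assms rc that by (auto simp: supported_on_def)
    then show ?thesis by simp
  next
    case False
    then have "D $$ (r, k) = 0" using assms rc that by (auto simp: supported_on_def)
    then show ?thesis by simp
  qed
  then show "(D * E) $$ (r, c) = 0\<^sub>m n n $$ (r, c)"
    using assms rc by (simp add: scalar_prod_def)
qed (use assms in auto)

text \<open>Write \<open>A = 1 + D\<close> and \<open>B = 1 + E\<close>. Both products are \<open>1 + D + E\<close>, as \<open>D E = 0 = E D\<close>.\<close>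

lemma commute_disjoint_supports:
  fixes A B :: "'a::comm_ring_1 mat"
  assumes A: "A \<in> carrier_mat n n" and B: "B \<in> carrier_mat n n"
    and "supported_on S (A - 1\<^sub>m n)" "supported_on T (B - 1\<^sub>m n)" "S \<inter> T = {}"
  shows "A * B = B * A"
proof -
  define D E where "D = A - 1\<^sub>m n" and "E = B - 1\<^sub>m n"
  have D: "D \<in> carrier_mat n n" and E: "E \<in> carrier_mat n n"
    using A B by (auto simp: D_def E_def)
  have AD: "A = 1\<^sub>m n + D" and BE: "B = 1\<^sub>m n + E"
    using A B by (auto simp: D_def E_def intro!: eq_matI)
  have "D * E = 0\<^sub>m n n" "E * D = 0\<^sub>m n n"
    using assms(3-5) D E by (auto simp: D_def E_def intro!: mult_disjoint_supports)
  then show ?thesis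
    unfolding AD BE using D E
    by (simp add: add_mult_distrib_mat[where nr=n and n=n and nc=n]
        mult_add_distrib_mat[where nr=n and n=n and nc=n])
      (auto intro!: eq_matI)
qed

text \<open>Matrix indices start at 0, so the block \<open>M\<close> of the \<open>i\<close>-th generator occupies the coordinates
  \<open>i - 1\<close> and \<open>i\<close>. The pairs belonging to indices that differ by at least 2 are disjoint.\<close>

lemma two_local_block_support:
  fixes M :: "'a::comm_ring_1 mat"
  assumes "M \<in> carrier_mat 2 2" "i \<in> {1..n-1}"
  shows "supported_on {i - 1, i} (diag_block_mat [1\<^sub>m (i - 1), M, 1\<^sub>m (n - i - 1)] - 1\<^sub>m n)"
proof -
  from assms(2) obtain j m where i: "i = Suc j" and n: "n = Suc (Suc (j + m))"
    by (intro that[of "i - 1" "n - i - 1"]) auto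
  have dim: "dim_row M = 2" "dim_col M = 2" using assms(1) by auto
  show ?thesis
    unfolding supported_on_def i n
    by (auto simp: Let_def dim)
qed

section \<open>The two extensions\<close>

lemma group_GL: "group (GL n)"
  unfolding GL_def
  by (rule monoid.units_group) (simp add: ring.is_monoid[OF ring_mat])

lemma GL_simps [simp]:
  "x \<otimes>\<^bsub>GL n\<^esub> y = x * y" "\<one>\<^bsub>GL n\<^esub> = 1\<^sub>m n"
  by (simp_all add: GL_def units_of_def ring_mat_def)

lemma GL_carrier_mat: "A \<in> carrier (GL n) \<Longrightarrow> A \<in> carrier_mat n n"
  by (auto simp: GL_def units_of_def ring_mat_def Units_def)

lemma GL_involution:
  "A \<in> carrier_mat n n \<Longrightarrow> A * A = 1\<^sub>m n \<Longrightarrow> A \<in> carrier (GL n)"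
  by (auto simp: GL_def units_of_def ring_mat_def Units_def)

text \<open>Each relation is an equality of two word classes, whose images under \<open>lam\<close> are the values of
  the two words; products associate to the right because \<open>word_val\<close> does.\<close>

lemma triplet_gen_relations:
  assumes lam: "lam \<in> hom (triplet_group n) (GL n)"
  shows "i \<in> {1..n-1} \<Longrightarrow> lam (triplet_gen n i) \<in> carrier (GL n)"
    and "i \<in> {1..n-1} \<Longrightarrow> lam (triplet_gen n i) * lam (triplet_gen n i) = 1\<^sub>m n"
    and "i \<in> {1..n-2} \<Longrightarrow>
      lam (triplet_gen n i) * (lam (triplet_gen n (i+1)) * lam (triplet_gen n i)) =
      lam (triplet_gen n (i+1)) * (lam (triplet_gen n i) * lam (triplet_gen n (i+1)))"
proof -
  let ?S = "Ell ` {1..n-1}" and ?R = "triplet_rels n"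
  interpret GL: group "GL n" by (rule group_GL)
  have hom: "lam \<in> hom (presented_group ?S ?R) (GL n)"
    using lam by (simp add: triplet_group_def)
  have car: "lam (triplet_gen n i) \<in> carrier (GL n)" if "i \<in> {1..n-1}" for i
    using that hom_in_carrier[OF hom]
    by (simp add: triplet_gen_def presented_gen_def presented_group_def)
  note cm = GL_carrier_mat[OF car]
  have eq: "word_val (GL n) (\<lambda>a. lam (presented_gen ?S ?R a)) u =
      word_val (GL n) (\<lambda>a. lam (presented_gen ?S ?R a)) v"
    if "(u, v) \<in> ?R" "u \<in> words ?S" "v \<in> words ?S" for u v
    by (simp only: presented_relation[OF that] that
        GL.hom_presented_word_class[OF hom, symmetric])
  show "i \<in> {1..n-1} \<Longrightarrow> lam (triplet_gen n i) \<in> carrier (GL n)"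
    by (rule car)
  show "lam (triplet_gen n i) * lam (triplet_gen n i) = 1\<^sub>m n" if "i \<in> {1..n-1}"
    using eq[of "pos [Ell i, Ell i]" "[]"] that cm[OF that]
    by (auto simp: triplet_rels_def pos_def triplet_gen_def)
  show "lam (triplet_gen n i) * (lam (triplet_gen n (i+1)) * lam (triplet_gen n i)) =
      lam (triplet_gen n (i+1)) * (lam (triplet_gen n i) * lam (triplet_gen n (i+1)))"
    if "i \<in> {1..n-2}"
  proof -
    have "i \<in> {1..n-1}" "i+1 \<in> {1..n-1}" using that by auto
    then show ?thesis
      using eq[of "pos [Ell i, Ell (i+1), Ell i]" "pos [Ell (i+1), Ell i, Ell (i+1)]"]
        that cm[of i] cm[of "i+1"]
      by (auto simp: triplet_rels_def pos_def triplet_gen_def)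
  qed
qed

text \<open>The scalar matrix of \<open>c\<close> is the central element of square 1 by which the \<open>\<rho>\<^sub>i\<close> are twisted;
  \<open>c = 1\<close> and \<open>c = -1\<close> give the two representations of the theorem.\<close>

lemma twisted_rep:
  fixes c :: complex
  assumes lam: "lam \<in> hom (triplet_group n) (GL n)" and "two_local n lam" and c: "c * c = 1"
    and f: "\<And>i. f (Ell i) = lam (triplet_gen n i)"
      "\<And>i. f (Rho i) = c \<cdot>\<^sub>m lam (triplet_gen n i)"
  shows "\<exists>\<phi>. defines_virtual_rep n f \<phi> \<and> induces_welded_rep n \<phi>"
proof -
  let ?a = "\<lambda>i. lam (triplet_gen n i)" and ?z = "c \<cdot>\<^sub>m 1\<^sub>m n :: complex mat"
  let ?V = "virtual_triplet_group n"
  interpret GL: group "GL n" by (rule group_GL)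
  interpret V: group ?V
    by (simp add: virtual_triplet_group_def presented_group_is_group)
  note a = triplet_gen_relations[OF lam]
  note cm = GL_carrier_mat[OF a(1)]
  have z: "?z * A = c \<cdot>\<^sub>m A" "A * ?z = c \<cdot>\<^sub>m A" if "A \<in> carrier_mat n n" for A
    using that mult_smult_assoc_mat[of "1\<^sub>m n" n n A n] mult_smult_distrib[of A n n "1\<^sub>m n" n] by auto
  have zz: "?z * ?z = 1\<^sub>m n"
    using c by (auto simp: z intro!: eq_matI)
  have far: "?a i * ?a j = ?a j * ?a i"
    if "i \<in> {1..n-1}" "j \<in> {1..n-1}" "i + 2 \<le> j" for i j
  proof -
    have supp: "supported_on {k - 1, k} (?a k - 1\<^sub>m n)" if k: "k \<in> {1..n-1}" for k
    proof -
      obtain M where M: "M \<in> carrier (GL 2)"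
        and "?a k = diag_block_mat [1\<^sub>m (k - 1), M, 1\<^sub>m (n - k - 1)]"
        using \<open>two_local n lam\<close> k unfolding two_local_def by blast
      with two_local_block_support[OF GL_carrier_mat[OF M] k] show ?thesis by (simp only:)
    qed
    show ?thesis
      using that by (intro commute_disjoint_supports[OF cm cm supp supp]) auto
  qed
  obtain \<phi> where \<phi>: "\<phi> \<in> hom ?V (GL n)"
    and gens: "\<And>g. g \<in> virtual_gens n \<Longrightarrow>
      \<phi> (virtual_gen n g) = twisted_assignment (GL n) ?a ?z g"
    and ker: "welded_relators n \<subseteq> kernel ?V (GL n) \<phi>"
    by (rule GL.twisted_virtual_hom[of n ?a ?z])
      (use a far zz z cm GL_involution[OF _ zz] in auto)
  have val: "\<phi> (virtual_gen n g) = f g" if "g \<in> virtual_gens n" for g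
    using that f cm by (auto simp: gens virtual_gens_def twisted_assignment_def z)
  have "\<psi> x = \<phi> x"
    if "\<psi> \<in> hom ?V (GL n)" "\<forall>g\<in>virtual_gens n. \<psi> (virtual_gen n g) = f g" "x \<in> carrier ?V"
    for \<psi> x
  proof (rule GL.hom_presented_unique)
    show "\<psi> (presented_gen (virtual_gens n) (virtual_rels n) g) =
        \<phi> (presented_gen (virtual_gens n) (virtual_rels n) g)" if "g \<in> virtual_gens n" for g
      using val[OF that] \<open>\<forall>g\<in>virtual_gens n. \<psi> (virtual_gen n g) = f g\<close> that
      by (simp add: virtual_gen_def)
  qed (use that \<phi> in \<open>simp_all add: virtual_triplet_group_def\<close>)
  then have "defines_virtual_rep n f \<phi>"
    unfolding defines_virtual_rep_def using \<phi> val by blast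
  moreover have "induces_welded_rep n \<phi>"
  proof -
    interpret \<phi>: group_hom ?V "GL n" \<phi>
      using \<phi> by unfold_locales
    have "welded_relators n \<subseteq> carrier ?V"
      using ker by (auto simp: kernel_def)
    then have "welded_kernel n \<lhd> ?V"
      unfolding welded_kernel_def by (rule normal_closure_normal[OF V.group_axioms])
    moreover have "welded_kernel n \<subseteq> kernel ?V (GL n) \<phi>"
      using ker \<phi>.normal_kernel by (auto simp: welded_kernel_def normal_closure_def)
    ultimately obtain \<mu> where "\<mu> \<in> hom (?V Mod welded_kernel n) (GL n)"
      "\<And>x. x \<in> carrier ?V \<Longrightarrow> \<mu> (welded_kernel n #>\<^bsub>?V\<^esub> x) = \<phi> x"
      by (rule \<phi>.FactGroup_universal_kernel) blast
    then show ?thesis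
      by (auto simp: induces_welded_rep_def welded_triplet_group_def welded_proj_def)
  qed
  ultimately show ?thesis by blast
qed

theorem proposition23:
  fixes n :: nat and lam :: "gen word set \<Rightarrow> complex mat"
  assumes "n \<ge> 3"
    and "lam \<in> hom (triplet_group n) (GL n)"
    and "two_local n lam"
  shows "(\<exists>\<phi>\<^sub>1. defines_virtual_rep n (lam_hat1 n lam) \<phi>\<^sub>1 \<and> induces_welded_rep n \<phi>\<^sub>1) \<and>
         (\<exists>\<phi>\<^sub>2. defines_virtual_rep n (lam_hat2 n lam) \<phi>\<^sub>2 \<and> induces_welded_rep n \<phi>\<^sub>2)"
proof
  show "\<exists>\<phi>. defines_virtual_rep n (lam_hat1 n lam) \<phi> \<and> induces_welded_rep n \<phi>"
    by (rule twisted_rep[OF assms(2,3), of 1]) (auto simp: lam_hat1_def)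
  show "\<exists>\<phi>. defines_virtual_rep n (lam_hat2 n lam) \<phi> \<and> induces_welded_rep n \<phi>"
    by (rule twisted_rep[OF assms(2,3), of "-1"]) (auto simp: lam_hat2_def intro!: eq_matI)
qed

end
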